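(* There is an absolutely continuous Borel probability measure $\nu$ on $[0,1]$ with density function $f$ having the property that $\dim_L\nu>0$, but $f\notin L^p$ for any $p>1$.
   Context: Absolutely continuous means with respect to Lebesgue measure. The lower Assouad dimension $\dim_L\nu$ is the supremum of all $\alpha$ for which there exist $C_1,C_2>0$ such that for all $0<r<R\le C_1$ and all $x\in\mathrm{supp}\,\nu$, $\nu(B(x,R))/\nu(B(x,r))\ge C_2(R/r)^\alpha$, where $B(x,R)$ is the open ball in $\mathbb{R}$ of centre $x$ and radius $R$. *)

theory Defs
  imports "HOL-Probability.Probability"
begin

definition measure_support :: "'a::topological_space measure \<Rightarrow> 'a set" where
  "measure_support \<nu> = {x. \<forall>U. open U \<longrightarrow> x \<in> U \<longrightarrow> emeasure \<nu> U > 0}"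

text \<open>The supremum is taken in the extended reals, where no boundedness side condition is needed.
  For a finite nonzero measure the denominator below is positive, since \<open>x\<close> lies in the support.\<close>

definition lower_assouad_dim :: "real measure \<Rightarrow> ereal" where
  "lower_assouad_dim \<nu> = Sup {ereal \<alpha> | \<alpha>. \<exists>C1>0. \<exists>C2>0. \<forall>r R. 0 < r \<longrightarrow> r < R \<longrightarrow> R \<le> C1 \<longrightarrow>
     (\<forall>x\<in>measure_support \<nu>.
        measure \<nu> (ball x R) / measure \<nu> (ball x r) \<ge> C2 * (R / r) powr \<alpha>)}"

text \<open>Membership in \<open>L\<^sup>p\<close> for \<open>0 < p \<le> \<infinity>\<close>; the value at other \<open>p\<close> is irrelevant.\<close>

definition in_Lp :: "'a measure \<Rightarrow> ereal \<Rightarrow> ('a \<Rightarrow> real) \<Rightarrow> bool" where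
  "in_Lp M p f \<longleftrightarrow> f \<in> borel_measurable M \<and>
     (if p = \<infinity> then \<exists>C. AE x in M. \<bar>f x\<bar> \<le> C
      else integrable M (\<lambda>x. \<bar>f x\<bar> powr real_of_ereal p))"

end

theory Submission
  imports Defs "HOL-Real_Asymp.Real_Asymp"
begin

text \<open>
  Positive lower Assouad dimension follows from \<^emph>\<open>reverse doubling\<close>: if enlarging a small ball by a
  fixed factor \<open>K\<close> always at least doubles its mass, then iterating over the scales
  between \<open>r\<close> and \<open>R\<close> gives the exponent \<open>log K 2\<close>. When it is demanded at all centres, and not
  only at those in the support, reverse doubling with given constants is a linear inequality in the
  measure, hence it is inherited by mixtures, whatever their weights.

  A single power singularity cannot give the example: \<open>\<bar>x\<bar> powr (\<alpha> - 1)\<close> with \<open>\<alpha> > 0\<close> still lies locally in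
  \<open>L\<^sup>p\<close> for some \<open>p > 1\<close>. Instead, take the uniform
  distributions on the successive stages of a Cantor set, each of which replaces an interval by its
  outer quarters. The \<open>n\<close>-th stage has length \<open>2 ^ - n\<close>, so its density takes only the values \<open>0\<close> and
  \<open>2 ^ n\<close>. Self-similarity yields reverse doubling with constants that do not depend on \<open>n\<close>
  (\<open>cantor_mass_reverse_doubling\<close>): above the scale \<open>2 ^ (- 2 * n)\<close> the stage looks like the Cantor
  set, of dimension \<open>1 / 2\<close>, and below it like Lebesgue measure.

  The measure \<open>\<nu>\<close> mixes the stages \<open>k\<^sup>2\<close> with the weights \<open>2 ^ - (k + 1)\<close>. Its density dominates each of
  its summands, so the integral of its \<open>p\<close>-th power is at least
  \<open>2 powr (k\<^sup>2 * (p - 1) - (k + 1) * p)\<close> for every \<open>k\<close>, and this is unbounded as soon as \<open>p > 1\<close>.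
\<close>

section \<open>Reverse doubling and the lower Assouad dimension\<close>

lemma reverse_doubling_iterate:
  fixes \<phi> :: "real \<Rightarrow> real"
  assumes K: "K > 1" and r: "r > 0"
    and dbl: "\<And>t. 0 < t \<Longrightarrow> t \<le> c \<Longrightarrow> 2 * \<phi> t \<le> \<phi> (K * t)"
    and le: "K ^ n * r \<le> c"
  shows "2 ^ n * \<phi> r \<le> \<phi> (K ^ n * r)"
  using le
proof (induction n)
  case 0
  then show ?case by simp
next
  case (Suc n)
  have "K ^ n * r \<le> K ^ Suc n * r"
    using K r by (intro mult_right_mono power_increasing) auto
  with Suc.prems have le: "K ^ n * r \<le> c" by linarith
  have "2 ^ Suc n * \<phi> r \<le> 2 * \<phi> (K ^ n * r)"
    using Suc.IH[OF le] by simp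
  also have "\<dots> \<le> \<phi> (K * (K ^ n * r))"
    using K r le by (intro dbl) auto
  finally show ?case by (simp add: mult.assoc)
qed

lemma lower_assouad_dim_pos_of_reverse_doubling:
  fixes \<nu> :: "real measure"
  assumes fin: "finite_measure \<nu>" and sets: "sets \<nu> = sets borel"
    and K: "K > 1" and c: "c > 0"
    and dbl: "\<And>x t. 0 < t \<Longrightarrow> t \<le> c \<Longrightarrow> 2 * measure \<nu> (ball x t) \<le> measure \<nu> (ball x (K * t))"
  shows "lower_assouad_dim \<nu> > 0"
proof -
  interpret finite_measure \<nu> by (rule fin)
  define \<alpha> where "\<alpha> = log K 2"
  have \<alpha>: "\<alpha> > 0" using K by (simp add: \<alpha>_def)
  have K\<alpha>: "K powr \<alpha> = 2" using K by (simp add: \<alpha>_def)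
  have bound: "measure \<nu> (ball x R) / measure \<nu> (ball x r) \<ge> 1 / 2 * (R / r) powr \<alpha>"
    if r: "0 < r" and rR: "r < R" and Rc: "R \<le> c" and x: "x \<in> measure_support \<nu>" for r R x
  proof -
    have "emeasure \<nu> (ball x r) > 0"
      using x r by (auto simp: measure_support_def)
    then have pos: "measure \<nu> (ball x r) > 0"
      by (simp add: emeasure_eq_measure)
    \<comment> \<open>Rounding the number of scales down to an integer loses at most one doubling: this is the
      factor \<open>1 / 2\<close>.\<close>
    define n where "n = nat \<lfloor>log K (R / r)\<rfloor>"
    have "log K (R / r) \<ge> 0" using K r rR by (simp add: zero_le_log_cancel_iff)
    then have n: "real n \<le> log K (R / r)" "log K (R / r) \<le> real n + 1"
      unfolding n_def by linarith+
    have "K powr real n \<le> R / r"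
      using n(1) K r rR by (simp add: le_log_iff)
    then have n1: "K ^ n * r \<le> R"
      using K r by (simp add: powr_realpow field_simps)
    have "R / r \<le> K powr (real n + 1)"
      using n(2) K r rR by (simp add: log_le_iff)
    then have "(R / r) powr \<alpha> \<le> (K powr (real n + 1)) powr \<alpha>"
      using \<alpha> r rR by (intro powr_mono2) auto
    also have "\<dots> = (K powr \<alpha>) powr (real n + 1)"
      by (simp add: powr_powr mult.commute)
    also have "\<dots> = 2 * 2 ^ n"
      by (simp add: K\<alpha> powr_add powr_realpow)
    finally have "1 / 2 * (R / r) powr \<alpha> \<le> 2 ^ n" by simp
    then have "1 / 2 * (R / r) powr \<alpha> * measure \<nu> (ball x r) \<le> 2 ^ n * measure \<nu> (ball x r)"
      using pos by (intro mult_right_mono) auto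
    also have "\<dots> \<le> measure \<nu> (ball x (K ^ n * r))"
      by (rule reverse_doubling_iterate[where \<phi> = "\<lambda>t. measure \<nu> (ball x t)" and c = c])
        (use K r dbl n1 Rc in auto)
    also have "\<dots> \<le> measure \<nu> (ball x R)"
      using n1 by (intro finite_measure_mono) (auto simp: sets)
    finally show ?thesis
      using pos by (simp add: field_simps)
  qed
  have "ereal \<alpha> \<le> lower_assouad_dim \<nu>"
    unfolding lower_assouad_dim_def
    by (intro Sup_upper CollectI exI[of _ \<alpha>] conjI refl exI[of _ c] exI[of _ "1 / 2 :: real"])
      (use c bound in auto)
  then show ?thesis using \<alpha> by (metis ereal_less(2) order_less_le_trans)
qed

section \<open>Uniform distributions on the stages of a Cantor set\<close>

fun cantor_density :: "nat \<Rightarrow> real \<Rightarrow> real" where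
  "cantor_density 0 x = indicator {0..1} x"
| "cantor_density (Suc n) x = 2 * (cantor_density n (4 * x) + cantor_density n (4 * x - 3))"

lemma cantor_density_nonneg [simp]: "cantor_density n x \<ge> 0"
  by (induction n arbitrary: x) auto

lemma cantor_density_measurable [measurable]: "cantor_density n \<in> borel_measurable borel"
proof (induction n)
  case 0
  have "cantor_density 0 = (\<lambda>x. indicator {0..1} x)" by auto
  then show ?case by simp
next
  case (Suc n)
  note [measurable] = Suc
  have "cantor_density (Suc n) = (\<lambda>x. 2 * (cantor_density n (4 * x) + cantor_density n (4 * x - 3)))"
    by auto
  then show ?case by simp
qed

lemma cantor_density_outside: "x \<notin> {0..1} \<Longrightarrow> cantor_density n x = 0"
  by (induction n arbitrary: x) auto

lemma cantor_density_values: "cantor_density n x = 0 \<or> cantor_density n x = 2 ^ n"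
proof (induction n arbitrary: x)
  case (Suc n)
  \<comment> \<open>The two copies live on the disjoint intervals \<open>{0..1/4}\<close> and \<open>{3/4..1}\<close>.\<close>
  have "cantor_density n (4 * x) = 0 \<or> cantor_density n (4 * x - 3) = 0"
    using cantor_density_outside[of "4 * x" n] cantor_density_outside[of "4 * x - 3" n]
    by (cases "4 * x \<in> {0..1}") auto
  then show ?case using Suc.IH[of "4 * x"] Suc.IH[of "4 * x - 3"] by auto
qed (auto simp: indicator_def)

lemma ennreal_mult_cancel_divide: "c \<noteq> 0 \<Longrightarrow> c \<noteq> top \<Longrightarrow> c * a / c = (a :: ennreal)"
  by (subst mult.commute) (rule ennreal_mult_divide_eq)

definition cantor_mass :: "nat \<Rightarrow> real set \<Rightarrow> ennreal" where
  "cantor_mass n A = (\<integral>\<^sup>+y. ennreal (cantor_density n y) * indicator A y \<partial>lborel)"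

lemma cantor_mass_mono: "A \<subseteq> B \<Longrightarrow> cantor_mass n A \<le> cantor_mass n B"
  unfolding cantor_mass_def by (intro nn_integral_mono) (auto simp: indicator_def)

lemma cantor_mass_Suc:
  assumes [measurable]: "A \<in> sets borel"
  shows "cantor_mass (Suc n) A =
    (cantor_mass n ((\<lambda>y. y / 4) -` A) + cantor_mass n ((\<lambda>y. (y + 3) / 4) -` A)) / 2"
proof -
  have affine: "(\<integral>\<^sup>+y. ennreal (cantor_density n (4 * y - b)) * indicator A y \<partial>lborel) =
      cantor_mass n ((\<lambda>y. (y + b) / 4) -` A) / 4" for b
  proof -
    have [measurable]: "(\<lambda>y. (y + b) / 4) -` A \<in> sets borel"
      by (rule measurable_sets_borel[where M = borel]) auto
    have "cantor_mass n ((\<lambda>y. (y + b) / 4) -` A) =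
      4 * (\<integral>\<^sup>+y. ennreal (cantor_density n (- b + 4 * y)) *
        indicator ((\<lambda>y. (y + b) / 4) -` A) (- b + 4 * y) \<partial>lborel)"
      unfolding cantor_mass_def by (subst nn_integral_real_affine[where c = 4 and t = "- b"]) auto
    also have "(\<lambda>y. ennreal (cantor_density n (- b + 4 * y)) *
        indicator ((\<lambda>y. (y + b) / 4) -` A) (- b + 4 * y)) =
        (\<lambda>y. ennreal (cantor_density n (4 * y - b)) * indicator A y)"
      by (auto simp: indicator_def algebra_simps)
    finally show ?thesis by (simp add: ennreal_mult_cancel_divide)
  qed
  have "cantor_mass (Suc n) A =
      (\<integral>\<^sup>+y. 2 * (ennreal (cantor_density n (4 * y - 0)) * indicator A y +
             ennreal (cantor_density n (4 * y - 3)) * indicator A y) \<partial>lborel)"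
    unfolding cantor_mass_def
    by (intro nn_integral_cong) (auto simp: indicator_def ennreal_mult)
  also have "\<dots> = 2 * (cantor_mass n ((\<lambda>y. y / 4) -` A) / 4 + cantor_mass n ((\<lambda>y. (y + 3) / 4) -` A) / 4)"
    using affine[of 0] affine[of 3]
    by (simp add: nn_integral_cmult nn_integral_add)
  also have "\<dots> = (cantor_mass n ((\<lambda>y. y / 4) -` A) + cantor_mass n ((\<lambda>y. (y + 3) / 4) -` A)) * (2 / 4)"
    by (simp add: divide_ennreal_def distrib_left distrib_right ac_simps)
  also have "(2 / 4 :: ennreal) = 1 / 2"
    using divide_ennreal[of 2 4] divide_ennreal[of 1 2] by simp
  finally show ?thesis by (simp add: ennreal_times_divide)
qed

lemma cantor_mass_total: "cantor_mass n UNIV = 1"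
  by (induction n) (simp_all add: cantor_mass_def[of 0] cantor_mass_Suc ennreal_indicator)

lemma cantor_mass_unit_interval:
  assumes "{0..1} \<subseteq> A"
  shows "cantor_mass n A = 1"
proof -
  have "ennreal (cantor_density n y) * indicator A y = ennreal (cantor_density n y) * indicator UNIV y" for y
    using assms cantor_density_outside[of y n] by (cases "y \<in> {0..1}") auto
  then have "cantor_mass n A = cantor_mass n UNIV" by (simp only: cantor_mass_def)
  then show ?thesis by (simp only: cantor_mass_total)
qed

lemma cantor_mass_le_1: "cantor_mass n A \<le> 1"
  using cantor_mass_mono[of A UNIV n] by (simp add: cantor_mass_total)

lemma cantor_mass_disjoint:
  assumes "A \<inter> {0..1} = {}"
  shows "cantor_mass n A = 0"
proof -
  have "ennreal (cantor_density n y) * indicator A y = 0" for y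
    using assms cantor_density_outside[of y n] by (cases "y \<in> A") (auto simp del: atLeastAtMost_iff)
  then show ?thesis by (simp only: cantor_mass_def) simp
qed

lemma vimage_ball_quarter: "(\<lambda>y. (y + b) / 4) -` ball x t = ball (4 * x - b) (4 * t)" for x b :: real
proof -
  have "dist (4 * x - b) y = 4 * dist x ((y + b) / 4)" for y
    unfolding dist_real_def abs_if by (simp add: field_simps)
  then show ?thesis by auto
qed

lemma cantor_mass_Suc_ball:
  "cantor_mass (Suc n) (ball x t) =
    (cantor_mass n (ball (4 * x) (4 * t)) + cantor_mass n (ball (4 * x - 3) (4 * t))) / 2"
  using vimage_ball_quarter[of 0 x t] vimage_ball_quarter[of 3 x t]
  by (simp add: cantor_mass_Suc)

lemma cantor_mass_0_reverse_doubling: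
  assumes t: "0 < t" "t \<le> 1 / 4"
  shows "2 * cantor_mass 0 (ball x t) \<le> cantor_mass 0 (ball x (20 * t))"
proof -
  have mass: "cantor_mass 0 A = emeasure lborel ({0..1} \<inter> A)" if "A \<in> sets borel" for A
  proof -
    have "cantor_mass 0 A = (\<integral>\<^sup>+y. indicator ({0..1} \<inter> A) y \<partial>lborel)"
      unfolding cantor_mass_def by (intro nn_integral_cong) (auto simp: indicator_def)
    with that show ?thesis by simp
  qed
  show ?thesis
  proof (cases "ball x t \<inter> {0..1} = {}")
    case False
    then have x: "- t < x" "x < 1 + t" by (auto simp: dist_real_def)
    have "cantor_mass 0 (ball x t) \<le> emeasure lborel {x - t..x + t}"
      by (subst mass) (auto intro!: emeasure_mono simp: dist_real_def)
    also have "\<dots> = ennreal (2 * t)" using t by simp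
    finally have "2 * cantor_mass 0 (ball x t) \<le> 2 * ennreal (2 * t)"
      by (intro mult_left_mono) auto
    also have "\<dots> = ennreal (4 * t)"
      using t by (simp add: ennreal_mult'[symmetric] flip: ennreal_numeral)
    also have "\<dots> \<le> cantor_mass 0 (ball x (20 * t))"
    proof -
      \<comment> \<open>The large ball contains an interval of length \<open>4 * t\<close> inside the unit interval.\<close>
      define a where "a = max 0 (min x (1 - 4 * t))"
      have a: "0 \<le> a" "a + 4 * t \<le> 1" "x - 20 * t < a" "a + 4 * t < x + 20 * t"
        using t x unfolding a_def by linarith+
      have "ennreal (4 * t) = emeasure lborel {a..a + 4 * t}" using t by simp
      also have "\<dots> \<le> emeasure lborel ({0..1} \<inter> ball x (20 * t))"
      proof (rule emeasure_mono)
        show "{a..a + 4 * t} \<subseteq> {0..1} \<inter> ball x (20 * t)"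
        proof
          fix y assume "y \<in> {a..a + 4 * t}"
          with a have "0 \<le> y" "y \<le> 1" "x - 20 * t < y" "y < x + 20 * t" by auto
          then show "y \<in> {0..1} \<inter> ball x (20 * t)"
            by (simp add: dist_real_def abs_less_iff)
        qed
      qed simp
      finally show ?thesis by (simp add: mass)
    qed
    finally show ?thesis .
  qed (simp add: cantor_mass_disjoint)
qed

text \<open>
  Self-similarity drives the induction. Balls of radius at most \<open>1 / 16\<close> are handled by passing to the
  two magnified copies. A ball of radius between \<open>1 / 16\<close> and \<open>1 / 4\<close> is too short to bridge the
  central gap, so it meets at most one copy and carries mass at most \<open>1 / 2\<close>, whereas the factor \<open>20\<close>
  makes its enlargement swallow the whole unit interval as soon as the ball meets it. Neither case
  worsens the constants, which is why they do not depend on \<open>n\<close>.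
\<close>

lemma cantor_mass_reverse_doubling:
  assumes "0 < t" "t \<le> 1 / 4"
  shows "2 * cantor_mass n (ball x t) \<le> cantor_mass n (ball x (20 * t))"
  using assms
proof (induction n arbitrary: x t)
  case 0
  then show ?case by (rule cantor_mass_0_reverse_doubling)
next
  case (Suc n)
  show ?case
  proof (cases "t \<le> 1 / 16")
    case True
    have "2 * cantor_mass n (ball (4 * x - b) (4 * t)) \<le> cantor_mass n (ball (4 * x - b) (4 * (20 * t)))" for b
      using Suc.IH[of "4 * t" "4 * x - b"] Suc.prems True by simp
    from add_mono[OF this[of 0] this[of 3]] show ?thesis
      unfolding cantor_mass_Suc_ball ennreal_times_divide
      by (intro divide_right_mono_ennreal) (simp add: distrib_left)
  next
    case False
    show ?thesis
    proof (cases "ball x t \<inter> {0..1} = {}")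
      case meets: False
      then have x: "- t < x" "x < 1 + t" by (auto simp: dist_real_def)
      have "{0..1} \<subseteq> ball x (20 * t)"
        using x False by (auto simp: dist_real_def)
      then have large: "cantor_mass (Suc n) (ball x (20 * t)) = 1"
        by (rule cantor_mass_unit_interval)
      have "ball (4 * x) (4 * t) \<inter> {0..1} = {} \<or> ball (4 * x - 3) (4 * t) \<inter> {0..1} = {}"
        using Suc.prems by (auto simp: dist_real_def)
      then have "cantor_mass n (ball (4 * x) (4 * t)) + cantor_mass n (ball (4 * x - 3) (4 * t)) \<le> 1"
        by (auto simp: cantor_mass_disjoint cantor_mass_le_1)
      then show ?thesis
        unfolding large unfolding cantor_mass_Suc_ball
        by (simp add: ennreal_times_divide ennreal_mult_cancel_divide del: distrib_left_numeral)
    qed (simp add: cantor_mass_disjoint)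
  qed
qed

lemma nn_integral_cantor_density_powr:
  assumes "a \<ge> 0" "p > 1"
  shows "(\<integral>\<^sup>+x. ennreal ((a * cantor_density n x) powr p) \<partial>lborel) =
    ennreal (a powr p * 2 powr (n * (p - 1)))"
proof -
  have pw: "(a * cantor_density n x) powr p =
      a powr p * 2 powr (n * (p - 1)) * cantor_density n x" for x
  proof (cases "cantor_density n x = 0")
    case False
    then have eq: "cantor_density n x = 2 powr n"
      using cantor_density_values[of n x] by (auto simp: powr_realpow)
    show ?thesis
      using assms unfolding eq
      by (simp add: powr_mult powr_powr algebra_simps flip: powr_add)
  qed simp
  have "(\<integral>\<^sup>+x. ennreal ((a * cantor_density n x) powr p) \<partial>lborel) =
      ennreal (a powr p * 2 powr (n * (p - 1))) * cantor_mass n UNIV"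
    unfolding pw cantor_mass_def by (simp add: ennreal_mult nn_integral_cmult)
  then show ?thesis by (simp add: cantor_mass_total)
qed

section \<open>The mixture\<close>

text \<open>
  The values are extended because the series may diverge on the Cantor set itself. The stages \<open>k\<^sup>2\<close>
  advance fast enough for their growth to beat the \<open>p\<close>-th powers of the geometric weights for every
  \<open>p > 1\<close>.
\<close>

definition mixture_density :: "real \<Rightarrow> ennreal" where
  "mixture_density x = (\<Sum>k. ennreal ((1 / 2) ^ Suc k * cantor_density (k\<^sup>2) x))"

lemma mixture_density_measurable [measurable]: "mixture_density \<in> borel_measurable borel"
  unfolding mixture_density_def by measurable

lemma emeasure_mixture:
  assumes [measurable]: "A \<in> sets borel"
  shows "emeasure (density lborel mixture_density) A = (\<Sum>k. ennreal ((1 / 2) ^ Suc k) * cantor_mass (k\<^sup>2) A)"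
proof -
  have "emeasure (density lborel mixture_density) A = (\<integral>\<^sup>+x. mixture_density x * indicator A x \<partial>lborel)"
    by (rule emeasure_density) auto
  also have "\<dots> = (\<integral>\<^sup>+x. (\<Sum>k. ennreal ((1 / 2) ^ Suc k * cantor_density (k\<^sup>2) x) * indicator A x) \<partial>lborel)"
    unfolding mixture_density_def by (simp only: ennreal_suminf_multc)
  also have "\<dots> = (\<Sum>k. \<integral>\<^sup>+x. ennreal ((1 / 2) ^ Suc k * cantor_density (k\<^sup>2) x) * indicator A x \<partial>lborel)"
    by (rule nn_integral_suminf) measurable
  also have "\<dots> = (\<Sum>k. ennreal ((1 / 2) ^ Suc k) * cantor_mass (k\<^sup>2) A)"
    unfolding cantor_mass_def
    by (simp add: ennreal_mult mult.assoc nn_integral_cmult del: power_Suc)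
  finally show ?thesis .
qed

lemma emeasure_mixture_unit_interval:
  assumes "A \<in> sets borel" "{0..1} \<subseteq> A"
  shows "emeasure (density lborel mixture_density) A = 1"
proof -
  have "(\<Sum>k. ennreal ((1 / 2) ^ Suc k)) = ennreal 1"
    by (intro suminf_ennreal_eq power_half_series) auto
  then show ?thesis
    using assms by (simp add: emeasure_mixture cantor_mass_unit_interval)
qed

lemma mixture_reverse_doubling:
  assumes "0 < t" "t \<le> 1 / 4"
  shows "2 * emeasure (density lborel mixture_density) (ball x t)
    \<le> emeasure (density lborel mixture_density) (ball x (20 * t))"
proof -
  have "2 * emeasure (density lborel mixture_density) (ball x t) =
      (\<Sum>k. ennreal ((1 / 2) ^ Suc k) * (2 * cantor_mass (k\<^sup>2) (ball x t)))"
    by (simp add: emeasure_mixture ac_simps flip: ennreal_suminf_cmult)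
  also have "\<dots> \<le> (\<Sum>k. ennreal ((1 / 2) ^ Suc k) * cantor_mass (k\<^sup>2) (ball x (20 * t)))"
    by (intro suminf_le mult_left_mono cantor_mass_reverse_doubling assms) auto
  finally show ?thesis by (simp add: emeasure_mixture)
qed

lemma AE_mixture_density_finite: "AE x in lborel. mixture_density x < \<infinity>"
proof -
  have "(\<integral>\<^sup>+x. mixture_density x \<partial>lborel) = 1"
    using emeasure_mixture_unit_interval[of UNIV] by (simp add: emeasure_density)
  then have "AE x in lborel. mixture_density x \<noteq> \<infinity>"
    by (intro nn_integral_PInf_AE) auto
  then show ?thesis by (simp add: top.not_eq_extremum)
qed

lemma stage_le_mixture_density:
  assumes "mixture_density x < \<infinity>"
  shows "(1 / 2) ^ Suc k * cantor_density (k\<^sup>2) x \<le> enn2real (mixture_density x)"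
proof -
  define g where "g = (\<lambda>k. ennreal ((1 / 2) ^ Suc k * cantor_density (k\<^sup>2) x))"
  have "sum g {k} \<le> suminf g" by (rule sum_le_suminf) auto
  then have "g k \<le> mixture_density x" by (simp add: mixture_density_def g_def)
  then have "enn2real (g k) \<le> enn2real (mixture_density x)"
    using assms by (intro enn2real_mono) auto
  moreover have "enn2real (g k) = (1 / 2) ^ Suc k * cantor_density (k\<^sup>2) x"
    unfolding g_def by (rule enn2real_ennreal) simp
  ultimately show ?thesis by simp
qed

lemma mixture_density_powr_not_integrable:
  assumes p: "p > 1"
  shows "\<not> integrable lborel (\<lambda>x. enn2real (mixture_density x) powr p)"
proof
  assume int: "integrable lborel (\<lambda>x. enn2real (mixture_density x) powr p)"
  define I where "I = (LINT x|lborel. enn2real (mixture_density x) powr p)"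
  have I: "(\<integral>\<^sup>+x. ennreal (enn2real (mixture_density x) powr p) \<partial>lborel) = ennreal I"
    unfolding I_def by (intro nn_integral_eq_integral int) auto
  have "I \<ge> 0" unfolding I_def by (intro integral_nonneg_AE) auto
  have bound: "2 powr ((real k)\<^sup>2 * (p - 1) - (real k + 1) * p) \<le> I" for k
  proof -
    have "((1 / 2) ^ Suc k) powr p = (2::real) powr (- (real k + 1) * p)"
    proof -
      have "(2::real) powr (- (real k + 1)) = inverse (2 powr real (Suc k))"
        by (simp add: add.commute flip: powr_minus)
      also have "\<dots> = (1 / 2) ^ Suc k"
        by (subst powr_realpow) (simp_all add: power_one_over inverse_eq_divide)
      finally have "((1 / 2 :: real) ^ Suc k) = 2 powr (- (real k + 1))" by (rule sym)
      then show ?thesis by (simp only: powr_powr)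
    qed
    then have "ennreal (2 powr ((real k)\<^sup>2 * (p - 1) - (real k + 1) * p)) =
        ennreal (((1 / 2) ^ Suc k) powr p * 2 powr (real (k\<^sup>2) * (p - 1)))"
      by (simp add: algebra_simps flip: powr_add)
    also have "\<dots> = (\<integral>\<^sup>+x. ennreal (((1 / 2) ^ Suc k * cantor_density (k\<^sup>2) x) powr p) \<partial>lborel)"
      by (rule nn_integral_cantor_density_powr[symmetric]) (use p in auto)
    also have "\<dots> \<le> (\<integral>\<^sup>+x. ennreal (enn2real (mixture_density x) powr p) \<partial>lborel)"
      using AE_mixture_density_finite
      by (intro nn_integral_mono_AE, eventually_elim)
        (use p stage_le_mixture_density in \<open>auto intro!: ennreal_leI powr_mono2 simp del: power_Suc\<close>)
    finally show ?thesis using I \<open>I \<ge> 0\<close> by simp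
  qed
  have "filterlim (\<lambda>k. 2 powr ((real k)\<^sup>2 * (p - 1) - (real k + 1) * p)) at_top sequentially"
    using p by real_asymp
  then have "eventually (\<lambda>k. 2 powr ((real k)\<^sup>2 * (p - 1) - (real k + 1) * p) > I) sequentially"
    by (simp add: filterlim_at_top_dense)
  then obtain k where "2 powr ((real k)\<^sup>2 * (p - 1) - (real k + 1) * p) > I"
    by (auto simp: eventually_sequentially)
  with bound[of k] show False by simp
qed

theorem proposition2p31:
  "\<exists>(\<nu> :: real measure) (f :: real \<Rightarrow> real).
     sets \<nu> = sets borel \<and> prob_space \<nu> \<and> emeasure \<nu> {0..1} = 1 \<and>
     absolutely_continuous lborel \<nu> \<and>
     f \<in> borel_measurable borel \<and> (\<forall>x. 0 \<le> f x) \<and> \<nu> = density lborel (\<lambda>x. ennreal (f x)) \<and>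
     lower_assouad_dim \<nu> > 0 \<and>
     (\<forall>p::ereal. p > 1 \<longrightarrow> \<not> in_Lp lborel p f)"
proof -
  \<comment> \<open>On the null set where the series diverges, \<open>f\<close> takes the default value \<open>0\<close>.\<close>
  define f where "f = (\<lambda>x. enn2real (mixture_density x))"
  define \<nu> where "\<nu> = density lborel mixture_density"
  have f [measurable]: "f \<in> borel_measurable borel" unfolding f_def by measurable
  have f_nonneg: "0 \<le> f x" for x by (simp add: f_def)
  have \<nu>_f: "\<nu> = density lborel (\<lambda>x. ennreal (f x))"
    unfolding \<nu>_def f_def using AE_mixture_density_finite
    by (intro density_cong) auto
  have sets_\<nu>: "sets \<nu> = sets borel" by (simp add: \<nu>_def)
  have prob: "prob_space \<nu>"
    using emeasure_mixture_unit_interval[of UNIV] by (intro prob_spaceI) (simp add: \<nu>_def)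
  interpret \<nu>: prob_space \<nu> by (rule prob)
  have "2 * measure \<nu> (ball x t) \<le> measure \<nu> (ball x (20 * t))" if "0 < t" "t \<le> 1 / 4" for x t
    using mixture_reverse_doubling[OF that, of x]
    by (simp add: \<nu>.emeasure_eq_measure ennreal_mult'[symmetric] flip: \<nu>_def ennreal_numeral)
  then have dim: "lower_assouad_dim \<nu> > 0"
    using \<nu>.finite_measure_axioms sets_\<nu>
    by (intro lower_assouad_dim_pos_of_reverse_doubling[where K = 20 and c = "1 / 4"]) auto
  have not_Lp: "\<not> in_Lp lborel p f" if p: "p > 1" for p :: ereal
  proof (cases p)
    case (real q)
    with p have "q > 1" by simp
    then show ?thesis
      using mixture_density_powr_not_integrable[of q] real by (simp add: in_Lp_def f_def)
  next
    case PInf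
    have "\<not> (AE x in lborel. \<bar>f x\<bar> \<le> C)" for C
    proof
      \<comment> \<open>A bounded probability density would be square-integrable.\<close>
      assume le: "AE x in lborel. \<bar>f x\<bar> \<le> C"
      have "integrable lborel f"
        using \<nu>.emeasure_space_1 f_nonneg
        by (intro integrableI_nonneg) (auto simp: \<nu>_f emeasure_density)
      then have int: "integrable lborel (\<lambda>x. C * f x)" by simp
      have "AE x in lborel. norm (f x powr 2) \<le> norm (C * f x)"
        using le
      proof eventually_elim
        case (elim x)
        then show ?case using f_nonneg[of x]
          by (auto simp: power2_eq_square intro!: mult_right_mono)
      qed
      from int _ this have "integrable lborel (\<lambda>x. f x powr 2)"
        by (rule Bochner_Integration.integrable_bound) simp
      with mixture_density_powr_not_integrable[of 2] show False by (simp add: f_def)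
    qed
    with PInf show ?thesis by (simp add: in_Lp_def)
  qed (use p in auto)
  have "absolutely_continuous lborel \<nu>"
    unfolding \<nu>_def by (rule absolutely_continuousI_density) simp
  moreover have "emeasure \<nu> {0..1} = 1"
    unfolding \<nu>_def by (rule emeasure_mixture_unit_interval) auto
  ultimately show ?thesis
    using sets_\<nu> prob f f_nonneg \<nu>_f dim not_Lp by blast
qed

end
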